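(* For any $L\ge 0$ and any cell representation $(\mathcal{C}(z))_{z\in\mathcal{T}_L}$ of $\mathcal{T}_L$, there exists a scaffolding.
   Context: $\mathbb{N}=\{0,1,2,\dots\}$, $(e_1,e_2,e_3)$ is the standard basis of $\mathbb{R}^3$, $\mathcal{T}_L=\{x_1e_1+x_2e_2+x_3e_3 : x_1,x_2,x_3\in\mathbb{N},\ x_1+x_2+x_3=L\}$, $s_1=e_1-e_3$, $s_2=e_2-e_1$, $s_3=e_3-e_2$, and $H=\lfloor L/2\rfloor$. Profile: for $z=ae_1+be_2+ce_3\in\mathcal{T}_L$, $p_0(z),\dots,p_H(z)$ are the coefficients of $x^0,\dots,x^H$ in $\frac{(1-x^{a+1})(1-x^{b+1})(1-x^{c+1})}{(1-x)^2}$. Cell representation of $\mathcal{T}_L$: a family $(\mathcal{C}(z))_{z\in\mathcal{T}_L}$ where each $\mathcal{C}(z)$ is a finite subset of $\{0,\dots,H\}\times\mathbb{Z}$ such that $|\{\ell : (f,\ell)\in\mathcal{C}(z)\}|=p_f(z)$ for every $f\in\{0,\dots,H\}$. The height of a cell $c=(f,\ell)$ is $h(c)=f$. By convention $\mathcal{C}(z)=\emptyset$ if $z\notin\mathcal{T}_L$. Allowed steps: for $f\in\{0,\dots,H\}$, a step $s\in\{\nearrow,\rightarrow,\searrow\}$ is allowed from height $f$ unless $(f,s)=(0,\searrow)$, or $(f,s)=(H,\nearrow)$, or $L$ is even and $(f,s)=(H,\rightarrow)$. Let $A(z)=\{(c,s)\in\mathcal{C}(z)\times\{\nearrow,\rightarrow,\searrow\}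 : s\text{ is allowed from height }h(c)\}$ and $\mathcal{C}_i(z)=\{(s_i,c): c\in\mathcal{C}(z)\}$ for $i\in\{1,2,3\}$. A scaffolding is a collection of functions $(\delta_z)_{z\in\mathcal{T}_L}$ such that for each $z\in\mathcal{T}_L$, $\delta_z:A(z)\to\mathcal{C}_1(z+s_1)\cup\mathcal{C}_2(z+s_2)\cup\mathcal{C}_3(z+s_3)$ is a bijection and, for every $(c,s)\in A(z)$ with $\delta_z(c,s)=(\sigma,c')$, one has $h(c')=h(c)+1$ if $s=\nearrow$, $h(c')=h(c)$ if $s=\rightarrow$, and $h(c')=h(c)-1$ if $s=\searrow$. *)

theory Defs
  imports "HOL-Analysis.Analysis" "HOL-Computational_Algebra.Formal_Power_Series"
begin

definition e1 :: "real^3" where "e1 = axis 1 1"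
definition e2 :: "real^3" where "e2 = axis 2 1"
definition e3 :: "real^3" where "e3 = axis 3 1"

definition point :: "nat \<Rightarrow> nat \<Rightarrow> nat \<Rightarrow> real^3" where
  "point a b c = real a *\<^sub>R e1 + real b *\<^sub>R e2 + real c *\<^sub>R e3"

definition triangle :: "nat \<Rightarrow> (real^3) set" where
  "triangle L = {point a b c | a b c. a + b + c = L}"

definition s1 :: "real^3" where "s1 = e1 - e3"
definition s2 :: "real^3" where "s2 = e2 - e1"
definition s3 :: "real^3" where "s3 = e3 - e2"

definition max_height :: "nat \<Rightarrow> nat" where
  "max_height L = L div 2"

(* The quotient has integer coefficients; it is taken over the rationals because
   division of formal power series is only well behaved over a field. *)
definition profile :: "nat \<Rightarrow> nat \<Rightarrow> nat \<Rightarrow> nat \<Rightarrow> rat" where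
  "profile a b c f =
     fps_nth ((1 - fps_X ^ (a + 1)) * (1 - fps_X ^ (b + 1)) * (1 - fps_X ^ (c + 1))
              / (1 - fps_X) ^ 2) f"

type_synonym cell = "nat \<times> int"

definition height :: "cell \<Rightarrow> nat" where
  "height c = fst c"

(* A family indexed by triangle L is a total function on real^3; the last conjunct is the
   convention that it is extended by the empty set. *)
definition cell_representation :: "nat \<Rightarrow> (real^3 \<Rightarrow> cell set) \<Rightarrow> bool" where
  "cell_representation L C \<longleftrightarrow>
     (\<forall>z \<in> triangle L. finite (C z) \<and> C z \<subseteq> {0..max_height L} \<times> UNIV) \<and>
     (\<forall>a b c. a + b + c = L \<longrightarrow>
        (\<forall>f \<in> {0..max_height L}. of_nat (card {l. (f, l) \<in> C (point a b c)}) = profile a b c f)) \<and>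
     (\<forall>z. z \<notin> triangle L \<longrightarrow> C z = {})"

(* NE, E, SE are the north-east, east and south-east arrows. *)
datatype step = NE | E | SE

definition allowed :: "nat \<Rightarrow> nat \<Rightarrow> step \<Rightarrow> bool" where
  "allowed L f s \<longleftrightarrow>
     f \<in> {0..max_height L} \<and>
     \<not> ((f, s) = (0, SE) \<or> (f, s) = (max_height L, NE) \<or> (even L \<and> (f, s) = (max_height L, E)))"

definition allowed_pairs :: "nat \<Rightarrow> (real^3 \<Rightarrow> cell set) \<Rightarrow> real^3 \<Rightarrow> (cell \<times> step) set" where
  "allowed_pairs L C z = {(c, s). c \<in> C z \<and> allowed L (height c) s}"

definition tagged_cells :: "(real^3 \<Rightarrow> cell set) \<Rightarrow> real^3 \<Rightarrow> real^3 \<Rightarrow> ((real^3) \<times> cell) set" where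
  "tagged_cells C \<sigma> z = {(\<sigma>, c) | c. c \<in> C z}"

fun height_change :: "step \<Rightarrow> int" where
  "height_change NE = 1"
| "height_change E = 0"
| "height_change SE = - 1"

(* Values of \<delta> z outside allowed_pairs L C z, or for z outside triangle L, are irrelevant. *)
definition scaffolding ::
  "nat \<Rightarrow> (real^3 \<Rightarrow> cell set) \<Rightarrow> (real^3 \<Rightarrow> cell \<times> step \<Rightarrow> (real^3) \<times> cell) \<Rightarrow> bool" where
  "scaffolding L C \<delta> \<longleftrightarrow>
     (\<forall>z \<in> triangle L.
        bij_betw (\<delta> z) (allowed_pairs L C z)
          (tagged_cells C s1 (z + s1) \<union> tagged_cells C s2 (z + s2) \<union> tagged_cells C s3 (z + s3)) \<and>
        (\<forall>(c, s) \<in> allowed_pairs L C z. \<forall>\<sigma> c'. \<delta> z (c, s) = (\<sigma>, c') \<longrightarrow>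
           int (height c') = int (height c) + height_change s))"

end

theory Submission
  imports Defs "HOL-Computational_Algebra.Polynomial_FPS"
begin

text \<open>
  It suffices to match, for every \<open>z\<close> and every height \<open>g\<close>, the number of allowed pairs at \<open>z\<close>
  that lead to height \<open>g\<close> with the number of cells of height \<open>g\<close> at the three neighbours of \<open>z\<close>.
  Writing \<open>P\<close> for the generating polynomial of the profile, expanding the products gives
  \<open>(1 + x + x\<^sup>2) P(z) - x (P(z + s\<^sub>1) + P(z + s\<^sub>2) + P(z + s\<^sub>3)) = 1 - x\<^sup>L\<^sup>+\<^sup>3\<close>,
  where \<open>P\<close> vanishes just outside the triangle; comparing coefficients of \<open>x\<^sup>g\<^sup>+\<^sup>1\<close> settles the count
  when no step is forbidden. At the top height the forbidden steps are accounted for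
  by the antisymmetry \<open>x\<^sup>L\<^sup>+\<^sup>1 P(1/x) = - P(x)\<close>.
\<close>

section \<open>The profile polynomial\<close>

text \<open>This is (1 - x^n) / (1 - x) in polynomial form. Three such factors over a denominator (1
  - x)^2 leave one factor 1 - x in the numerator.\<close>

definition geom_poly :: "nat \<Rightarrow> rat poly" where
  "geom_poly n = (\<Sum>i<n. monom 1 i)"

text \<open>The arguments are shifted by one, so that an argument \<open>0\<close> describes a point just outside
  the triangle.\<close>

definition profile_poly :: "nat \<Rightarrow> nat \<Rightarrow> nat \<Rightarrow> rat poly" where
  "profile_poly a b c = [:1, -1:] * geom_poly a * geom_poly b * geom_poly c"

lemma coeff_geom_poly: "coeff (geom_poly n) k = (if k < n then 1 else 0)"
  by (simp add: geom_poly_def coeff_sum)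

lemma geom_poly_times_one_minus: "[:1, -1:] * geom_poly n = 1 - [:0, 1:] ^ n"
proof -
  have "1 - [:0, 1:] ^ n = (1 - [:0, 1:]) * (\<Sum>i<n. [:0, 1::rat:] ^ i)"
    by (rule one_diff_power_eq)
  moreover have "(1 - [:0, 1::rat:]) = [:1, -1:]"
    by (simp add: one_pCons)
  ultimately show ?thesis
    by (simp add: geom_poly_def monom_altdef)
qed

text \<open>Together with the factor in \<open>profile_poly\<close> there are three copies of 1 - x,
  one for each geometric sum.\<close>

lemma profile_poly_times_square:
  "[:1, -1:] ^ 2 * profile_poly a b c = (1 - [:0, 1:] ^ a) * (1 - [:0, 1:] ^ b) * (1 - [:0, 1:] ^ c)"
  unfolding profile_poly_def geom_poly_times_one_minus[symmetric]
  by (simp only: power2_eq_square ac_simps)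

lemma profile_poly_zero:
  "profile_poly 0 b c = 0" "profile_poly a 0 c = 0" "profile_poly a b 0 = 0"
  by (simp_all add: profile_poly_def geom_poly_def)

lemma profile_eq_coeff:
  "profile a b c f = coeff (profile_poly (a + 1) (b + 1) (c + 1)) f"
proof -
  have x: "fps_of_poly [:0, 1::rat:] = fps_X" "fps_of_poly [:1, -1::rat:] = 1 - fps_X"
    by (simp_all add: fps_of_poly_pCons)
  have "(1 - fps_X ^ (a + 1)) * (1 - fps_X ^ (b + 1)) * (1 - fps_X ^ (c + 1)) =
      fps_of_poly ([:1, -1:] ^ 2 * profile_poly (a + 1) (b + 1) (c + 1))"
    unfolding profile_poly_times_square
    by (simp only: fps_of_poly_mult fps_of_poly_diff fps_of_poly_power x fps_of_poly_1)
  also have "\<dots> = (1 - fps_X) ^ 2 * fps_of_poly (profile_poly (a + 1) (b + 1) (c + 1))"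
    by (simp only: fps_of_poly_mult fps_of_poly_power x)
  finally have eq: "(1 - fps_X ^ (a + 1)) * (1 - fps_X ^ (b + 1)) * (1 - fps_X ^ (c + 1)) =
    (1 - fps_X) ^ 2 * fps_of_poly (profile_poly (a + 1) (b + 1) (c + 1))" .
  \<comment> \<open>The constant coefficient is 1, so the denominator cancels.\<close>
  have "(1 - fps_X :: rat fps) ^ 2 \<noteq> 0"
    using fps_nonzeroI[of "1 - fps_X :: rat fps" 0] by simp
  then show ?thesis
    unfolding profile_def eq by simp
qed

text \<open>With \<open>A\<close>, \<open>B\<close>, \<open>D\<close> standing for x^a, x^b, x^c,
  shifts of the exponents become factors x or x^2, and the recurrence becomes an identity in four
  independent variables.\<close>

lemma recurrence_identity:
  fixes x A B D :: "'a::comm_ring_1"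
  shows "(1 + x + x * x) * ((1 - A * x) * (1 - B * x) * (1 - D * x)) -
      x * ((1 - A * x\<^sup>2) * (1 - B * x) * (1 - D) + (1 - A) * (1 - B * x\<^sup>2) * (1 - D * x)
        + (1 - A * x) * (1 - B) * (1 - D * x\<^sup>2)) =
    (1 - x)\<^sup>2 * (1 - A * B * D * x ^ 3)"
  by (simp add: algebra_simps power2_eq_square power3_eq_cube)

lemma profile_poly_recurrence:
  "[:1, 1, 1:] * profile_poly (a + 1) (b + 1) (c + 1) -
     [:0, 1:] * (profile_poly (a + 2) (b + 1) c + profile_poly a (b + 2) (c + 1)
       + profile_poly (a + 1) b (c + 2)) = 1 - [:0, 1:] ^ (a + b + c + 3)" (is "?l = ?r")
proof -
  let ?x = "[:0, 1::rat:]"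
  have d: "[:1, -1::rat:] = 1 - ?x" and q: "[:1, 1, 1::rat:] = 1 + ?x + ?x * ?x"
    by (simp_all add: one_pCons)
  \<comment> \<open>The identity is checked after multiplication by (1 - x)^2, which is nonzero and
    cancels at the end.\<close>
  have "[:1, -1:] ^ 2 * ?l = [:1, 1, 1:] * ([:1, -1:] ^ 2 * profile_poly (a + 1) (b + 1) (c + 1)) -
     ?x * ([:1, -1:] ^ 2 * profile_poly (a + 2) (b + 1) c
       + [:1, -1:] ^ 2 * profile_poly a (b + 2) (c + 1)
       + [:1, -1:] ^ 2 * profile_poly (a + 1) b (c + 2))"
    by (simp only: algebra_simps)
  also have "\<dots> = [:1, -1:] ^ 2 * ?r"
    unfolding profile_poly_times_square unfolding d q power_add power_one_right by (rule recurrence_identity)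
  finally show ?thesis
    by simp
qed

text \<open>Compare coefficients of x^(f+1). The bound on \<open>f\<close> gives 0 < f+1 < a+b+c+3,
  so neither term of 1 - x^(a+b+c+3) contributes.\<close>

lemma profile_recurrence:
  assumes "f < a + b + c + 2"
  shows "(if f = 0 then 0 else profile a b c (f - 1)) + profile a b c f + profile a b c (f + 1) =
    coeff (profile_poly (a + 2) (b + 1) c) f + coeff (profile_poly a (b + 2) (c + 1)) f
    + coeff (profile_poly (a + 1) b (c + 2)) f"
proof -
  have "coeff (1 - [:0, 1::rat:] ^ (a + b + c + 3)) (Suc f) = 0"
    using assms by (simp flip: monom_altdef[of 1, simplified])
  then show ?thesis
    unfolding profile_poly_recurrence[symmetric] profile_eq_coeff
    by (cases f) (simp_all add: coeff_pCons)
qed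

section \<open>Antisymmetry of the profile\<close>

lemma degree_geom_poly: "degree (geom_poly (Suc n)) = n"
  by (rule antisym) (auto intro!: degree_le le_degree simp: coeff_geom_poly)

lemma reflect_geom_poly: "reflect_poly (geom_poly (Suc n)) = geom_poly (Suc n)"
  by (rule poly_eqI) (auto simp: coeff_reflect_poly degree_geom_poly coeff_geom_poly)

text \<open>Reversing coefficients fixes each geometric sum and negates 1 - x.\<close>

lemma profile_antisym:
  assumes "f \<le> a + b + c + 1"
  shows "profile a b c (a + b + c + 1 - f) = - profile a b c f"
proof -
  let ?P = "profile_poly (Suc a) (Suc b) (Suc c)"
  have nz: "geom_poly (Suc n) \<noteq> 0" for n
    using coeff_geom_poly[of "Suc n" 0] by force
  have deg: "degree ?P = a + b + c + 1"
    unfolding profile_poly_def by (simp add: degree_mult_eq nz degree_geom_poly del: mult_pCons_left)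
  have "reflect_poly [:1, -1::rat:] = - [:1, -1:]"
    by (simp add: reflect_poly_def)
  then have "reflect_poly ?P = - ?P"
    unfolding profile_poly_def reflect_poly_mult reflect_geom_poly by (simp only: mult_minus_left)
  then have "coeff (reflect_poly ?P) f = - coeff ?P f"
    by simp
  then show ?thesis
    using assms by (simp add: coeff_reflect_poly deg profile_eq_coeff)
qed

text \<open>The reflection sends f to 2H + 2 - f and fixes H + 1, so this coefficient is its own
  negative.\<close>

lemma profile_top_odd:
  assumes "a + b + c = 2 * H + 1"
  shows "profile a b c (H + 1) = 0"
  using profile_antisym[of "H + 1" a b c] assms by simp

text \<open>Here the reflection exchanges H and H + 1.\<close>

lemma profile_top_even:
  assumes "a + b + c = 2 * H"
  shows "profile a b c (H + 1) = - profile a b c H"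
  using profile_antisym[of H a b c] assms by simp

section \<open>Counting cells\<close>

text \<open>Bijections between corresponding fibres are glued together. Images of different fibres
  cannot collide because \<open>g\<close> tells them apart.\<close>

lemma bij_betw_respecting:
  assumes "finite A" "finite B"
    and "\<And>k. card {x \<in> A. f x = k} = card {y \<in> B. g y = k}"
  obtains h where "bij_betw h A B" "\<And>x. x \<in> A \<Longrightarrow> g (h x) = f x"
proof -
  have "\<exists>h. bij_betw h {x \<in> A. f x = k} {y \<in> B. g y = k}" for k
    using assms by (intro finite_same_card_bij) auto
  then obtain H where H: "\<And>k. bij_betw (H k) {x \<in> A. f x = k} {y \<in> B. g y = k}"
    by metis
  define h where "h x = H (f x) x" for x
  have h: "h x \<in> B" "g (h x) = f x" if "x \<in> A" for x
    using bij_betwE[OF H[of "f x"]] that by (auto simp: h_def)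
  have "bij_betw h A B"
  proof (rule bij_betw_imageI)
    show "inj_on h A"
    proof (rule inj_onI)
      fix x y assume xy: "x \<in> A" "y \<in> A" "h x = h y"
      then have "f x = f y"
        using h by metis
      then show "x = y"
        using xy bij_betw_imp_inj_on[OF H[of "f x"]] by (auto simp: h_def inj_on_def)
    qed
    show "h ` A = B"
    proof
      show "B \<subseteq> h ` A"
      proof
        fix y assume "y \<in> B"
        then have "y \<in> H (g y) ` {x \<in> A. f x = g y}"
          using bij_betw_imp_surj_on[OF H[of "g y"]] by auto
        then obtain x where "x \<in> A" "y = h x"
          by (auto simp: h_def)
        then show "y \<in> h ` A"
          by blast
      qed
    qed (use h in auto)
  qed
  then show thesis
    using h that by blast
qed

section \<open>Coordinates and moves in the triangle\<close>

lemma point_nth: "point a b c $ 1 = real a" "point a b c $ 2 = real b" "point a b c $ 3 = real c"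
  by (simp_all add: point_def e1_def e2_def e3_def axis_def)

lemma step_vector_nth:
  "s1 $ 1 = 1" "s1 $ 2 = 0" "s1 $ 3 = -1"
  "s2 $ 1 = -1" "s2 $ 2 = 1" "s2 $ 3 = 0"
  "s3 $ 1 = 0" "s3 $ 2 = -1" "s3 $ 3 = 1"
  by (simp_all add: s1_def s2_def s3_def e1_def e2_def e3_def axis_def)

lemma step_vectors_distinct: "s1 \<noteq> s2" "s1 \<noteq> s3" "s2 \<noteq> s3"
  by (simp_all add: vec_eq_iff forall_3 step_vector_nth)

lemma point_step:
  "point a b (Suc c) + s1 = point (Suc a) b c"
  "point (Suc a) b c + s2 = point a (Suc b) c"
  "point a (Suc b) c + s3 = point a b (Suc c)"
  by (simp_all add: vec_eq_iff forall_3 step_vector_nth point_nth)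

lemma point_step_outside:
  "point a b 0 + s1 \<notin> triangle L"
  "point 0 b c + s2 \<notin> triangle L"
  "point a 0 c + s3 \<notin> triangle L"
  by (auto simp: triangle_def vec_eq_iff forall_3 step_vector_nth point_nth)

lemma card_height: "card {c \<in> X. height c = f} = card {l. (f, l) \<in> X}"
proof -
  have "{c \<in> X. height c = f} = Pair f ` {l. (f, l) \<in> X}"
    by (auto simp: height_def)
  then show ?thesis
    by (simp add: card_image inj_on_def)
qed

section \<open>Cell counts at a point and its neighbours\<close>

context
  fixes L :: nat and C :: "real^3 \<Rightarrow> cell set"
  assumes C: "cell_representation L C"
begin

lemma finite_cells: "finite (C z)"
  using C unfolding cell_representation_def by (cases "z \<in> triangle L") auto

lemma cell_height_le: "c \<in> C z \<Longrightarrow> height c \<le> L div 2"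
  using C unfolding cell_representation_def height_def max_height_def
  by (cases "z \<in> triangle L") fastforce+

lemma cells_outside: "z \<notin> triangle L \<Longrightarrow> C z = {}"
  using C unfolding cell_representation_def by blast

lemma card_cells:
  assumes "a + b + c = L" "f \<le> L div 2"
  shows "of_nat (card {x \<in> C (point a b c). height x = f}) = profile a b c f"
  using C assms unfolding cell_representation_def card_height max_height_def by simp

lemma card_cells_neighbours:
  assumes L: "a + b + c = L" and f: "f \<le> L div 2"
  shows "of_nat (card {x \<in> C (point a b c + s1). height x = f}) = coeff (profile_poly (a + 2) (b + 1) c) f"
    and "of_nat (card {x \<in> C (point a b c + s2). height x = f}) = coeff (profile_poly a (b + 2) (c + 1)) f"
    and "of_nat (card {x \<in> C (point a b c + s3). height x = f}) = coeff (profile_poly (a + 1) b (c + 2)) f"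
proof -
  show "of_nat (card {x \<in> C (point a b c + s1). height x = f}) = coeff (profile_poly (a + 2) (b + 1) c) f"
  \<comment> \<open>If the coordinate to be lowered is 0, the neighbour has no cells and the
    polynomial has the factor \<open>geom_poly 0\<close>, which is 0.\<close>
  proof (cases c)
    case (Suc c')
    then show ?thesis
      using card_cells[of "Suc a" b c'] L f by (simp add: point_step profile_eq_coeff)
  qed (simp add: cells_outside point_step_outside profile_poly_zero)
  show "of_nat (card {x \<in> C (point a b c + s2). height x = f}) = coeff (profile_poly a (b + 2) (c + 1)) f"
  proof (cases a)
    case (Suc a')
    then show ?thesis
      using card_cells[of a' "Suc b" c] L f by (simp add: point_step profile_eq_coeff)
  qed (simp add: cells_outside point_step_outside profile_poly_zero)
  show "of_nat (card {x \<in> C (point a b c + s3). height x = f}) = coeff (profile_poly (a + 1) b (c + 2)) f"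
  proof (cases b)
    case (Suc b')
    then show ?thesis
      using card_cells[of a b' "Suc c"] L f by (simp add: point_step profile_eq_coeff)
  qed (simp add: cells_outside point_step_outside profile_poly_zero)
qed

lemma card_allowed_pairs:
  assumes L: "a + b + c = L" and g: "g \<le> L div 2"
  shows "of_nat (card {(x, s) \<in> allowed_pairs L C (point a b c).
      int (height x) + height_change s = int g}) =
    (if g = 0 then 0 else profile a b c (g - 1)) + profile a b c g + profile a b c (g + 1)"
    (is "of_nat (card ?S) = _")
proof -
  let ?z = "point a b c" and ?H = "L div 2"
  define N where "N f = {x \<in> C ?z. height x = f}" for f
  \<comment> \<open>\<open>U\<close>, \<open>V\<close>, \<open>W\<close> are the sources of
    \<open>NE\<close>, \<open>E\<close>, \<open>SE\<close> steps ending at height \<open>g\<close>.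
    Forbidden \<open>NE\<close> and \<open>SE\<close> steps would end outside the height range, so
    only the ban on \<open>E\<close> has to be built in.\<close>
  define U where "U = (if g = 0 then {} else N (g - 1))"
  define V where "V = (if even L \<and> g = ?H then {} else N g)"
  define W where "W = (if g = ?H then {} else N (g + 1))"
  have fin: "finite U" "finite V" "finite W"
    by (auto simp: U_def V_def W_def N_def finite_cells)
  have "?S = (\<lambda>x. (x, NE)) ` U \<union> (\<lambda>x. (x, E)) ` V \<union> (\<lambda>x. (x, SE)) ` W" (is "_ = ?T")
  proof (rule set_eqI)
    fix y :: "cell \<times> step"
    obtain x s where y: "y = (x, s)"
      by (cases y)
    have "x \<in> C ?z \<Longrightarrow> height x \<le> ?H"
      by (rule cell_height_le)
    then show "y \<in> ?S \<longleftrightarrow> y \<in> ?T"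
      using g unfolding y U_def V_def W_def N_def allowed_pairs_def allowed_def max_height_def
      by (cases s) auto
  qed
  also have "card ?T = card U + card V + card W"
    using fin by (subst card_Un_disjoint; (subst card_Un_disjoint)?)
      (auto simp: card_image inj_on_def)
  finally have "card ?S = card U + card V + card W" .
  moreover have N: "of_nat (card (N f)) = profile a b c f" if "f \<le> ?H" for f
    using card_cells[OF L that] by (simp add: N_def)
  have "of_nat (card U) = (if g = 0 then 0 else profile a b c (g - 1))"
    using N[of "g - 1"] g by (simp add: U_def)
  moreover have "of_nat (card V) + of_nat (card W) = profile a b c g + profile a b c (g + 1)"
  \<comment> \<open>At the top no cell lies above to descend from. For odd \<open>L\<close> the term
    at \<open>g + 1\<close> is 0; for even \<open>L\<close> it cancels the term at \<open>g\<close>,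
    matching the missing \<open>E\<close> steps.\<close>
  proof (cases "g = ?H")
    case True
    show ?thesis
    proof (cases "even L")
      case e: True
      then have "a + b + c = 2 * ?H"
        using L by simp
      from profile_top_even[OF this] True e show ?thesis
        by (simp add: V_def W_def)
    next
      case o: False
      then have "a + b + c = 2 * ?H + 1"
        using L by simp
      from profile_top_odd[OF this] True o N[of g] show ?thesis
        by (simp add: V_def W_def)
    qed
  next
    case False
    then show ?thesis
      using N[of g] N[of "g + 1"] g by (simp add: V_def W_def)
  qed
  ultimately show ?thesis
    by simp
qed

lemma card_tagged_cells:
  "card {(\<sigma>, x) \<in> tagged_cells C s1 (z + s1) \<union> tagged_cells C s2 (z + s2) \<union> tagged_cells C s3 (z + s3).
      height x = g} =
    card {x \<in> C (z + s1). height x = g} + card {x \<in> C (z + s2). height x = g}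
      + card {x \<in> C (z + s3). height x = g}" (is "card ?S = card ?U + card ?V + card ?W")
proof -
  have fin: "finite ?U" "finite ?V" "finite ?W"
    by (simp_all add: finite_cells)
  have "?S = Pair s1 ` ?U \<union> Pair s2 ` ?V \<union> Pair s3 ` ?W"
    by (auto simp: tagged_cells_def)
  also have "card \<dots> = card ?U + card ?V + card ?W"
    using fin step_vectors_distinct
    by (subst card_Un_disjoint; (subst card_Un_disjoint)?) (auto simp: card_image inj_on_def)
  finally show ?thesis .
qed

section \<open>The bijection at one point\<close>

lemma scaffolding_at_point:
  assumes L: "a + b + c = L"
  defines "z \<equiv> point a b c"
  defines "B \<equiv> tagged_cells C s1 (z + s1) \<union> tagged_cells C s2 (z + s2) \<union> tagged_cells C s3 (z + s3)"
  obtains h where "bij_betw h (allowed_pairs L C z) B"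
    "\<And>x s. (x, s) \<in> allowed_pairs L C z \<Longrightarrow>
      int (height (snd (h (x, s)))) = int (height x) + height_change s"
proof -
  let ?A = "allowed_pairs L C z"
  \<comment> \<open>Sources are classified by the height they lead to and targets by their own
    height, so a bijection respecting \<open>u\<close> and \<open>v\<close> obeys the height
    rule.\<close>
  define u where "u = (\<lambda>(x, s). int (height x) + height_change s)"
  define v where "v = (\<lambda>(\<sigma> :: real^3, x). int (height x))"
  have finU: "finite (UNIV :: step set)"
  proof -
    have "(UNIV :: step set) = {NE, E, SE}"
      using step.exhaust by auto
    then show ?thesis
      by (metis finite.emptyI finite_insert)
  qed
  have "?A \<subseteq> C z \<times> UNIV"
    by (auto simp: allowed_pairs_def)
  then have fA: "finite ?A"
    using finite_cells finU by (meson finite_SigmaI finite_subset)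
  have "B \<subseteq> {s1, s2, s3} \<times> (C (z + s1) \<union> C (z + s2) \<union> C (z + s3))"
    by (auto simp: B_def tagged_cells_def)
  then have fB: "finite B"
    by (rule finite_subset) (simp add: finite_cells)
  have "card {y \<in> ?A. u y = k} = card {y \<in> B. v y = k}" for k
  proof (cases "0 \<le> k \<and> k \<le> int (L div 2)")
    case True
    then obtain g where k: "k = int g" and g: "g \<le> L div 2"
      by (metis nonneg_int_cases of_nat_le_iff)
    have A: "{y \<in> ?A. u y = k} = {(x, s) \<in> ?A. int (height x) + height_change s = int g}"
      by (auto simp: u_def k)
    have B: "{y \<in> B. v y = k} = {(\<sigma>, x) \<in> B. height x = g}"
      by (auto simp: v_def k)
    have "(of_nat (card {y \<in> ?A. u y = k}) :: rat) = of_nat (card {y \<in> B. v y = k})"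
      unfolding A B unfolding B_def card_tagged_cells of_nat_add unfolding z_def
        card_allowed_pairs[OF L g] card_cells_neighbours[OF L g]
      using L g by (intro profile_recurrence) linarith
    then show ?thesis
      by simp
  next
    case False
    \<comment> \<open>Outside the height range both fibres are empty: on the source side because
      \<open>SE\<close> from 0 and \<open>NE\<close> from the top are forbidden.\<close>
    have "{y \<in> B. v y = k} = {}"
      using False cell_height_le by (fastforce simp: B_def v_def tagged_cells_def)
    moreover have "u y \<noteq> k" if "y \<in> ?A" for y
    proof -
      obtain x s where y: "y = (x, s)"
        by (cases y)
      show ?thesis
        using False that unfolding y u_def allowed_pairs_def allowed_def max_height_def
        by (cases s) auto
    qed
    then have "{y \<in> ?A. u y = k} = {}"
      by blast
    ultimately show ?thesis
      by (simp only: card.empty)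
  qed
  from bij_betw_respecting[OF fA fB this] obtain h
    where "bij_betw h ?A B" and h: "\<And>y. y \<in> ?A \<Longrightarrow> v (h y) = u y"
    by blast
  moreover have "int (height (snd (h (x, s)))) = int (height x) + height_change s"
    if "(x, s) \<in> ?A" for x s
    using h[OF that] by (simp add: u_def v_def split: prod.splits)
  ultimately show thesis
    using that by blast
qed

end

theorem proposition26:
  fixes L :: nat and C :: "real^3 \<Rightarrow> cell set"
  assumes "cell_representation L C"
  shows "\<exists>\<delta>. scaffolding L C \<delta>"
proof -
  have "\<forall>z \<in> triangle L. \<exists>h. bij_betw h (allowed_pairs L C z)
      (tagged_cells C s1 (z + s1) \<union> tagged_cells C s2 (z + s2) \<union> tagged_cells C s3 (z + s3)) \<and>
    (\<forall>(x, s) \<in> allowed_pairs L C z. \<forall>\<sigma> x'. h (x, s) = (\<sigma>, x') \<longrightarrow>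
      int (height x') = int (height x) + height_change s)"
  proof
    fix z assume "z \<in> triangle L"
    then obtain a b c where L: "a + b + c = L" and z: "z = point a b c"
      by (auto simp: triangle_def)
    obtain h where h: "bij_betw h (allowed_pairs L C z)
        (tagged_cells C s1 (z + s1) \<union> tagged_cells C s2 (z + s2) \<union> tagged_cells C s3 (z + s3))"
      "\<And>x s. (x, s) \<in> allowed_pairs L C z \<Longrightarrow>
        int (height (snd (h (x, s)))) = int (height x) + height_change s"
      using scaffolding_at_point[OF assms L] unfolding z by blast
    show "\<exists>h. bij_betw h (allowed_pairs L C z)
        (tagged_cells C s1 (z + s1) \<union> tagged_cells C s2 (z + s2) \<union> tagged_cells C s3 (z + s3)) \<and>
      (\<forall>(x, s) \<in> allowed_pairs L C z. \<forall>\<sigma> x'. h (x, s) = (\<sigma>, x') \<longrightarrow>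
        int (height x') = int (height x) + height_change s)"
      using h by (intro exI[of _ h] conjI ballI) (auto, metis snd_conv)
  qed
  then show ?thesis
    unfolding scaffolding_def by (rule bchoice)
qed

end
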